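(* Let $\beta>0$ and $\mathcal F_\beta(x)=x^\top D x+\beta\|x\|_0$. Then the set of global minimizers of $\mathcal F_\beta$ over $\mathcal X$, $$\hat X=\left\{\hat x\in\mathcal X:\ \mathcal F_\beta(\hat x)=\min_{x\in\mathcal X}\mathcal F_\beta(x)\right\},$$ is nonempty.
   Context: Data: $N\ge 1$; $D\in\mathbb R^{N\times N}$ is a symmetric positive definite matrix with diagonal entries $D_{ii}$; $\hat r\in\mathbb R^N$; $r_c,\bar r\in\mathbb R$; $\gamma>0$. Set $\mathfrak r=\hat r-r_c\mathbf 1\in\mathbb R^N$ (with entries $\mathfrak r[i]$, where $\mathbf 1$ is the all-ones vector) and $\bar{\mathfrak r}=\bar r-r_c$. Notation: $\|x\|_D=\sqrt{x^\top D x}$; $\|x\|_0$ is the number of nonzero entries of $x$. The feasible set is $\mathcal X=\{x\in\mathbb R^N:\ \mathfrak r^\top x-\gamma\|x\|_D\ge\bar{\mathfrak r}\}$. Standing assumptions: (1) $\bar r>r_c$, i.e. $\bar{\mathfrak r}>0$; (2) $\min_{1\le i\le N}|\mathfrak r[i]|/\sqrt{D_{ii}}>\gamma$. *)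

theory Defs
  imports "HOL-Analysis.Analysis"
begin

definition sym_pos_def :: "real ^ 'n ^ 'n \<Rightarrow> bool" where
  "sym_pos_def D \<longleftrightarrow> transpose D = D \<and> (\<forall>x. x \<noteq> 0 \<longrightarrow> 0 < x \<bullet> (D *v x))"

definition norm_wrt :: "real ^ 'n ^ 'n \<Rightarrow> real ^ 'n \<Rightarrow> real" where
  "norm_wrt D x = sqrt (x \<bullet> (D *v x))"

definition norm0 :: "real ^ 'n \<Rightarrow> nat" where
  "norm0 x = card {i. x $ i \<noteq> 0}"

definition excess :: "real ^ 'n \<Rightarrow> real \<Rightarrow> real ^ 'n" where
  "excess r_hat r_c = r_hat - r_c *\<^sub>R (\<chi> i. 1)"

definition feasible_set ::
  "real ^ 'n ^ 'n \<Rightarrow> real ^ 'n \<Rightarrow> real \<Rightarrow> real \<Rightarrow> real \<Rightarrow> (real ^ 'n) set" where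
  "feasible_set D r_hat r_c r_bar \<gamma> =
     {x. excess r_hat r_c \<bullet> x - \<gamma> * norm_wrt D x \<ge> r_bar - r_c}"

definition objective :: "real ^ 'n ^ 'n \<Rightarrow> real \<Rightarrow> real ^ 'n \<Rightarrow> real" where
  "objective D \<beta> x = x \<bullet> (D *v x) + \<beta> * real (norm0 x)"

definition global_minimizers :: "('a \<Rightarrow> real) \<Rightarrow> 'a set \<Rightarrow> 'a set" where
  "global_minimizers f S = {x \<in> S. \<forall>y\<in>S. f x \<le> f y}"

end

theory Submission
  imports Defs
begin

text \<open>
  The cardinality term makes the objective discontinuous, so compactness cannot be applied to it
  directly. It is, however, constant on each set of vectors with a prescribed support, and there
  are only finitely many supports. Fixing a set \<open>S\<close> of coordinates that are allowed to be nonzero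
  turns the problem into the minimization of the continuous, coercive quadratic form \<open>x \<bullet> (D *v x)\<close>
  over a closed set, which has a solution \<open>p S\<close> whenever that set is nonempty
  (\<open>pos_def_form_attains_inf\<close>). The set \<open>S\<close> with the least
  value of \<open>p S \<bullet> (D *v p S) + \<beta> * card S\<close> then gives a global minimizer: allowing coordinates in
  \<open>S\<close> to vanish is harmless because it can only make the penalty smaller than \<open>\<beta> * card S\<close>
  (\<open>sparse_penalized_attains_min\<close>).

  This argument needs a feasible point. Along a coordinate axis, in the direction of the sign of
  the excess return, the constraint function grows linearly with slope
  \<open>\<bar>excess r_hat r_c $ i\<bar> - \<gamma> * sqrt (D $ i $ i)\<close>, which is positive by the assumption on the
  ratios; so any target return is met far enough along the axis (\<open>feasible_set_nonempty\<close>).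
\<close>

lemma continuous_on_quadratic_form:
  fixes D :: "real ^ 'n ^ 'n"
  shows "continuous_on S (\<lambda>x. x \<bullet> (D *v x))"
  by (intro continuous_on_inner continuous_on_id linear_continuous_on
      matrix_vector_mul_bounded_linear)

text \<open>
  The constant is the minimum of the form on the unit sphere; homogeneity of degree two carries the
  bound to all vectors.
\<close>

lemma pos_def_form_coercive:
  fixes D :: "real ^ 'n ^ 'n"
  assumes "\<And>x. x \<noteq> 0 \<Longrightarrow> 0 < x \<bullet> (D *v x)"
  obtains c where "c > 0" and "\<And>x. c * (norm x)\<^sup>2 \<le> x \<bullet> (D *v x)"
proof -
  have "axis undefined 1 \<in> sphere (0 :: real ^ 'n) 1"
    by simp
  then obtain u where u: "u \<in> sphere (0 :: real ^ 'n) 1"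
    and u_min: "\<And>y. y \<in> sphere 0 1 \<Longrightarrow> u \<bullet> (D *v u) \<le> y \<bullet> (D *v y)"
    using continuous_attains_inf[OF compact_sphere _ continuous_on_quadratic_form]
    by blast
  have "u \<noteq> 0"
    using u by auto
  show thesis
  proof
    show "u \<bullet> (D *v u) > 0"
      using assms \<open>u \<noteq> 0\<close> by blast
    fix x :: "real ^ 'n"
    show "u \<bullet> (D *v u) * (norm x)\<^sup>2 \<le> x \<bullet> (D *v x)"
    proof (cases "x = 0")
      case False
      define y where "y = (1 / norm x) *\<^sub>R x"
      have "y \<in> sphere 0 1"
        using False by (simp add: y_def)
      have x: "x = norm x *\<^sub>R y"
        using False by (simp add: y_def)
      have "x \<bullet> (D *v x) = (norm x)\<^sup>2 * (y \<bullet> (D *v y))"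
        by (subst (1 2) x) (simp add: matrix_vector_mult_scaleR power2_eq_square)
      then show ?thesis
        using mult_left_mono[OF u_min[OF \<open>y \<in> sphere 0 1\<close>], of "(norm x)\<^sup>2"]
        by (simp add: mult.commute)
    qed simp
  qed
qed

text \<open>
  By coercivity, only a bounded part of the closed set competes with any given point of it.
\<close>

lemma pos_def_form_attains_inf:
  fixes D :: "real ^ 'n ^ 'n"
  assumes pos: "\<And>x. x \<noteq> 0 \<Longrightarrow> 0 < x \<bullet> (D *v x)"
    and "closed C" and "C \<noteq> {}"
  shows "\<exists>x\<in>C. \<forall>y\<in>C. x \<bullet> (D *v x) \<le> y \<bullet> (D *v y)"
proof -
  let ?q = "\<lambda>x. x \<bullet> (D *v x)"
  obtain x0 where "x0 \<in> C"
    using \<open>C \<noteq> {}\<close> by blast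
  obtain c where "c > 0" and c: "\<And>x. c * (norm x)\<^sup>2 \<le> ?q x"
    using pos_def_form_coercive[OF pos] by blast
  define K where "K = C \<inter> {x. ?q x \<le> ?q x0}"
  have "norm x \<le> sqrt (?q x0 / c)" if "x \<in> K" for x
  proof (rule real_le_rsqrt)
    have "c * (norm x)\<^sup>2 \<le> ?q x0"
      using c[of x] that by (simp add: K_def)
    then show "(norm x)\<^sup>2 \<le> ?q x0 / c"
      using \<open>c > 0\<close> by (simp add: field_simps)
  qed
  then have "bounded K"
    by (auto intro: boundedI)
  moreover have "closed K"
    unfolding K_def
    by (intro closed_Int \<open>closed C\<close> closed_Collect_le continuous_on_quadratic_form
        continuous_on_const)
  ultimately have "compact K"
    by (simp add: compact_eq_bounded_closed)
  moreover have "x0 \<in> K"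
    by (simp add: K_def \<open>x0 \<in> C\<close>)
  then have "K \<noteq> {}"
    by blast
  ultimately have "\<exists>x\<in>K. \<forall>y\<in>K. ?q x \<le> ?q y"
    by (rule continuous_attains_inf[OF _ _ continuous_on_quadratic_form])
  then obtain x where "x \<in> K" and min: "\<And>y. y \<in> K \<Longrightarrow> ?q x \<le> ?q y"
    by blast
  have "?q x \<le> ?q y" if "y \<in> C" for y
  proof (cases "y \<in> K")
    case False
    then show ?thesis
      using that \<open>x \<in> K\<close> by (simp add: K_def)
  qed (rule min)
  then show ?thesis
    using \<open>x \<in> K\<close> by (auto simp: K_def)
qed

text \<open>
  The vectors supported inside a fixed \<open>S\<close> form a closed set, whereas those with support exactly
  \<open>S\<close> in general do not; this is why the subproblems are indexed by supersets of the support.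
\<close>

lemma sparse_penalized_attains_min:
  fixes D :: "real ^ 'n ^ 'n"
  assumes pos: "\<And>x. x \<noteq> 0 \<Longrightarrow> 0 < x \<bullet> (D *v x)"
    and "closed C" and "C \<noteq> {}" and "\<beta> \<ge> 0"
  shows "global_minimizers (objective D \<beta>) C \<noteq> {}"
proof -
  let ?q = "\<lambda>x. x \<bullet> (D *v x)"
  define supported where "supported S = {x \<in> C. \<forall>i\<in>-S. x $ i = 0}" for S
  define \<S> where "\<S> = {S. supported S \<noteq> {}}"
  have "closed (supported S)" for S
  proof -
    have "supported S = C \<inter> (\<Inter>i\<in>-S. {x. x $ i = 0})"
      by (auto simp: supported_def)
    then show ?thesis
      by (auto intro!: closed_Int \<open>closed C\<close> closed_INT closed_Collect_eq
          continuous_on_component continuous_on_id continuous_on_const)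
  qed
  then have "\<forall>S\<in>\<S>. \<exists>x\<in>supported S. \<forall>y\<in>supported S. ?q x \<le> ?q y"
    using pos_def_form_attains_inf[OF pos] by (simp add: \<S>_def)
  then obtain p where p: "\<And>S. S \<in> \<S> \<Longrightarrow> p S \<in> supported S"
    and p_min: "\<And>S y. S \<in> \<S> \<Longrightarrow> y \<in> supported S \<Longrightarrow> ?q (p S) \<le> ?q y"
    using bchoice[of \<S> "\<lambda>S x. x \<in> supported S \<and> (\<forall>y\<in>supported S. ?q x \<le> ?q y)"]
    by blast
  define v where "v S = ?q (p S) + \<beta> * real (card S)" for S
  have support_mem: "y \<in> supported {i. y $ i \<noteq> 0}" if "y \<in> C" for y
    using that by (simp add: supported_def)
  have "\<S> \<noteq> {}"
    using \<open>C \<noteq> {}\<close> support_mem by (auto simp: \<S>_def)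
  define T where "T = arg_min_on v \<S>"
  have "T \<in> \<S>"
    unfolding T_def using \<open>\<S> \<noteq> {}\<close> by (intro arg_min_if_finite finite)
  have T: "v T \<le> v S" if "S \<in> \<S>" for S
    unfolding T_def using \<open>\<S> \<noteq> {}\<close> that by (intro arg_min_least finite)
  have "objective D \<beta> (p T) \<le> objective D \<beta> y" if "y \<in> C" for y
  proof -
    let ?S = "{i. y $ i \<noteq> 0}"
    have "?S \<in> \<S>"
      using support_mem[OF that] by (auto simp: \<S>_def)
    have "norm0 (p T) \<le> card T"
      using p[OF \<open>T \<in> \<S>\<close>] by (auto simp: norm0_def supported_def intro!: card_mono)
    then have "objective D \<beta> (p T) \<le> v T"
      using \<open>\<beta> \<ge> 0\<close> by (simp add: objective_def v_def mult_left_mono)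
    also have "\<dots> \<le> v ?S"
      by (rule T[OF \<open>?S \<in> \<S>\<close>])
    also have "\<dots> \<le> objective D \<beta> y"
      using p_min[OF \<open>?S \<in> \<S>\<close> support_mem[OF that]] by (simp add: objective_def v_def norm0_def)
    finally show ?thesis .
  qed
  moreover have "p T \<in> C"
    using p[OF \<open>T \<in> \<S>\<close>] by (simp add: supported_def)
  ultimately have "p T \<in> global_minimizers (objective D \<beta>) C"
    by (simp add: global_minimizers_def)
  then show ?thesis
    by blast
qed

lemma closed_feasible_set: "closed (feasible_set D r_hat r_c r_bar \<gamma>)"
proof -
  have "continuous_on UNIV (norm_wrt D)"
    unfolding norm_wrt_def by (rule continuous_on_real_sqrt[OF continuous_on_quadratic_form])
  then have "continuous_on UNIV (\<lambda>x. excess r_hat r_c \<bullet> x - \<gamma> * norm_wrt D x)"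
    by (intro continuous_on_diff continuous_on_inner continuous_on_mult_left
        continuous_on_const continuous_on_id)
  then show ?thesis
    unfolding feasible_set_def by (rule closed_Collect_le[OF continuous_on_const])
qed

lemma quadratic_form_axis:
  fixes D :: "real ^ 'n ^ 'n"
  shows "axis i a \<bullet> (D *v axis i a) = a\<^sup>2 * D $ i $ i"
proof -
  have "axis i a = a *\<^sub>R (axis i 1 :: real ^ 'n)"
    by (simp add: axis_def vec_eq_iff)
  then show ?thesis
    by (simp add: matrix_vector_mult_scaleR matrix_vector_mult_basis inner_axis' column_def
        power2_eq_square)
qed

text \<open>
  A single asset with large enough excess return per unit of risk suffices: the constraint function
  is positively homogeneous, so it is enough that it is positive at one point.
\<close>

lemma feasible_set_nonempty:
  fixes D :: "real ^ 'n ^ 'n"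
  assumes "D $ i $ i > 0"
    and "\<bar>excess r_hat r_c $ i\<bar> / sqrt (D $ i $ i) > \<gamma>"
    and "r_bar \<ge> r_c"
  shows "feasible_set D r_hat r_c r_bar \<gamma> \<noteq> {}"
proof -
  let ?r = "excess r_hat r_c $ i"
  define slope where "slope = \<bar>?r\<bar> - \<gamma> * sqrt (D $ i $ i)"
  have "slope > 0"
    using assms(1,2) by (simp add: slope_def field_simps)
  define t where "t = (r_bar - r_c) / slope"
  have "t \<ge> 0"
    using \<open>slope > 0\<close> \<open>r_bar \<ge> r_c\<close> by (simp add: t_def)
  \<comment> \<open>A long position if the excess return is nonnegative, a short one otherwise; \<open>sgn\<close> would
    vanish at zero.\<close>
  define a where "a = (if ?r \<ge> 0 then t else - t)"
  define x :: "real ^ 'n" where "x = axis i a"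
  have "norm_wrt D x = t * sqrt (D $ i $ i)"
    using \<open>t \<ge> 0\<close> by (simp add: norm_wrt_def x_def quadratic_form_axis real_sqrt_mult a_def)
  moreover have "excess r_hat r_c \<bullet> x = t * \<bar>?r\<bar>"
    by (simp add: x_def inner_axis a_def)
  ultimately have "excess r_hat r_c \<bullet> x - \<gamma> * norm_wrt D x = t * slope"
    by (simp add: slope_def algebra_simps)
  also have "\<dots> = r_bar - r_c"
    using \<open>slope > 0\<close> by (simp add: t_def)
  finally have "x \<in> feasible_set D r_hat r_c r_bar \<gamma>"
    by (simp add: feasible_set_def)
  then show ?thesis
    by blast
qed

theorem theorem2:
  fixes D :: "real ^ 'n ^ 'n" and r_hat :: "real ^ 'n" and r_c r_bar \<gamma> \<beta> :: real
  assumes "sym_pos_def D"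
    and "\<gamma> > 0"
    and "r_bar > r_c"
    and "(MIN i. \<bar>excess r_hat r_c $ i\<bar> / sqrt (D $ i $ i)) > \<gamma>"
    and "\<beta> > 0"
  shows "global_minimizers (objective D \<beta>) (feasible_set D r_hat r_c r_bar \<gamma>) \<noteq> {}"
proof (rule sparse_penalized_attains_min)
  show pos: "0 < x \<bullet> (D *v x)" if "x \<noteq> 0" for x
    using \<open>sym_pos_def D\<close> that by (simp add: sym_pos_def_def)
  fix i :: 'n
  have "D $ i $ i > 0"
    using pos[of "axis i 1"] by (simp add: quadratic_form_axis axis_eq_0_iff)
  moreover have "\<bar>excess r_hat r_c $ i\<bar> / sqrt (D $ i $ i) > \<gamma>"
    using assms(4) by (simp add: Min_gr_iff)
  ultimately show "feasible_set D r_hat r_c r_bar \<gamma> \<noteq> {}"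
    using \<open>r_bar > r_c\<close> by (intro feasible_set_nonempty) auto
qed (use closed_feasible_set \<open>\<beta> > 0\<close> in auto)

end
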